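(* Let $s$ be a positive integer. Then, as $n\to\infty$ over positive integers, \[ \frac{1}{n^{s+1}}\sum_{x=1}^n \Big\{\frac{n}{x}\Big\}\,x^{s} = \frac{1}{s} - \frac{\zeta(s+1)}{s+1} + O\Big(\frac{1}{\sqrt{n}}\Big), \] where $\zeta$ is the Riemann zeta function and the implied constant may depend on $s$.
   Context: For a real number $y$, $[y]$ denotes the floor of $y$ and $\{y\} = y - [y]$ its fractional part. $\zeta(z)=\sum_{x\ge1} x^{-z}$ for $z>1$. *)

theory Defs
  imports "HOL-Analysis.Analysis" "HOL-Library.Landau_Symbols"
begin

text \<open>The Dirichlet series over \<open>x \<ge> 1\<close>, with the summation index shifted by one;
  meaningful only for \<open>z > 1\<close>, where it converges.\<close>

definition zeta :: "real \<Rightarrow> real" where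
  "zeta z = (\<Sum>x. real (Suc x) powr (- z))"

end

theory Submission
  imports Defs
begin

text \<open>Write \<open>{n/x} = n/x - [n/x]\<close>. The first part contributes \<open>n \<Sum> x^(s-1) = n^(s+1)/s + O(n^s)\<close>.
  In the second, \<open>[n/x]\<close> counts the \<open>m\<close> with \<open>m x \<le> n\<close>, so exchanging the summations gives
  \<open>\<Sum>\<^sub>m \<Sum>\<^sub>x\<^sub>\<le>\<^sub>n\<^sub>/\<^sub>m x^s = \<Sum>\<^sub>m ((n/m)^(s+1)/(s+1) + O((n/m)^s))\<close>, whose main term is a partial sum of
  \<open>\<zeta>(s+1)\<close> and whose error is \<open>O(n^s \<Sum> 1/m)\<close>; the crude bound \<open>\<Sum> 1/m \<le> 2 \<surd>n\<close> suffices.\<close>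

text \<open>The mean value estimate for the power k + 1, obtained by induction without
  derivatives.\<close>

lemma power_Suc_diff_bounds:
  fixes a b :: real
  assumes "0 \<le> a" "a \<le> b"
  shows "(real k + 1) * a ^ k * (b - a) \<le> b ^ Suc k - a ^ Suc k"
    and "b ^ Suc k - a ^ Suc k \<le> (real k + 1) * b ^ k * (b - a)"
proof (induction k)
  case (Suc k)
  \<comment> \<open>Two ways of splitting the same difference: the one with factor \<open>a\<close>
    on the old difference yields the lower bound, the one with factor \<open>b\<close> the upper
    bound. In each, the remaining term is then estimated through a^(k+1) \<le> b^(k+1).\<close>
  have eq: "b ^ Suc (Suc k) - a ^ Suc (Suc k) = b * (b ^ Suc k - a ^ Suc k) + a ^ Suc k * (b - a)"
    "b ^ Suc (Suc k) - a ^ Suc (Suc k) = a * (b ^ Suc k - a ^ Suc k) + b ^ Suc k * (b - a)"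
    by (simp_all add: algebra_simps)
  {
    case 1
    have "a * ((real k + 1) * a ^ k * (b - a)) \<le> a * (b ^ Suc k - a ^ Suc k)"
      using Suc.IH(1) assms by (intro mult_left_mono)
    moreover have "a ^ Suc k * (b - a) \<le> b ^ Suc k * (b - a)"
      using assms by (intro mult_right_mono power_mono) auto
    ultimately show ?case unfolding eq(2) by (simp add: algebra_simps)
  next
    case 2
    have "b * (b ^ Suc k - a ^ Suc k) \<le> b * ((real k + 1) * b ^ k * (b - a))"
      using Suc.IH(2) assms by (intro mult_left_mono) auto
    moreover have "a ^ Suc k * (b - a) \<le> b ^ Suc k * (b - a)"
      using assms by (intro mult_right_mono power_mono) auto
    ultimately show ?case unfolding eq(1) by (simp add: algebra_simps)
  }
qed auto

text \<open>The middle term is the integral of x^k from \<open>a\<close> to \<open>b\<close>,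
  enclosed between the rectangles of heights a^k and b^k.\<close>

corollary power_Suc_divide_diff_bounds:
  fixes a b :: real
  assumes "0 \<le> a" "a \<le> b"
  shows "a ^ k * (b - a) \<le> b ^ Suc k / (real k + 1) - a ^ Suc k / (real k + 1)"
    and "b ^ Suc k / (real k + 1) - a ^ Suc k / (real k + 1) \<le> b ^ k * (b - a)"
proof -
  have k: "0 < real k + 1" by simp
  show "a ^ k * (b - a) \<le> b ^ Suc k / (real k + 1) - a ^ Suc k / (real k + 1)"
    and "b ^ Suc k / (real k + 1) - a ^ Suc k / (real k + 1) \<le> b ^ k * (b - a)"
    using power_Suc_diff_bounds[OF assms, of k]
    unfolding diff_divide_distrib[symmetric] pos_le_divide_eq[OF k] pos_divide_le_eq[OF k]
    by (simp_all only: mult_ac)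
qed

text \<open>Rectangles of width 1, summed by induction. Right endpoints give the lower bound; left
  endpoints control only the terms with x < N, whence the extra N^k.\<close>

lemma sum_power_bounds:
  shows "real N ^ Suc k / (real k + 1) \<le> (\<Sum>x=1..N. real x ^ k)"
    and "(\<Sum>x=1..N. real x ^ k) \<le> real N ^ Suc k / (real k + 1) + real N ^ k"
proof (induction N)
  case (Suc N)
  note diff = power_Suc_divide_diff_bounds[of "real N" "real (Suc N)" k]
  {
    case 1
    have "real (Suc N) ^ Suc k / (real k + 1) \<le> real N ^ Suc k / (real k + 1) + real (Suc N) ^ k"
      using diff(2) by (simp del: power_Suc)
    then show ?case using Suc.IH(1) by simp
  next
    case 2
    have "real N ^ Suc k / (real k + 1) + real N ^ k \<le> real (Suc N) ^ Suc k / (real k + 1)"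
      using diff(1) by (simp del: power_Suc)
    then show ?case using Suc.IH(2) by simp
  }
qed auto

text \<open>The sum exceeds N^(k+1)/(k+1) by at most N^k, and replacing \<open>N\<close> by
  \<open>y\<close> raises the main term by at most y^k. The two errors have opposite effect, so they
  do not add up.\<close>

lemma sum_power_upto_approx:
  fixes y :: real
  assumes "real N \<le> y" "y \<le> real N + 1"
  shows "\<bar>(\<Sum>x=1..N. real x ^ k) - y ^ Suc k / (real k + 1)\<bar> \<le> y ^ k"
proof -
  have y0: "0 \<le> y" using assms(1) by linarith
  have pw: "real N ^ k \<le> y ^ k" using assms by (intro power_mono) auto
  have "y ^ Suc k / (real k + 1) - real N ^ Suc k / (real k + 1) \<le> y ^ k * (y - real N)"
    using assms by (intro power_Suc_divide_diff_bounds) auto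
  also have "\<dots> \<le> y ^ k * 1"
    using assms y0 by (intro mult_left_mono) auto
  finally have "y ^ Suc k / (real k + 1) \<le> real N ^ Suc k / (real k + 1) + y ^ k"
    by simp
  moreover have "real N ^ Suc k / (real k + 1) \<le> y ^ Suc k / (real k + 1)"
    using assms by (intro divide_right_mono power_mono) auto
  ultimately show ?thesis
    using sum_power_bounds(1)[of N k] sum_power_bounds(2)[where N = N and k = k] pw by linarith
qed

lemma multiplier_set_eq:
  fixes n x :: nat
  assumes "x > 0"
  shows "{m\<in>{1..n}. m * x \<le> n} = {1..n div x}"
proof -
  have "m \<le> n" if "m * x \<le> n" for m
    by (rule order_trans[OF _ that]) (use assms in simp)
  then show ?thesis using assms by (auto simp: less_eq_div_iff_mult_less_eq)
qed

lemma sum_floor_div_mult: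
  fixes f :: "nat \<Rightarrow> real"
  shows "(\<Sum>x=1..n. real_of_int \<lfloor>real n / real x\<rfloor> * f x) = (\<Sum>m=1..n. \<Sum>x=1..n div m. f x)"
proof -
  have "real_of_int \<lfloor>real n / real x\<rfloor> * f x = (\<Sum>m\<in>{m\<in>{1..n}. m * x \<le> n}. f x)"
    if "x \<in> {1..n}" for x
    using that by (subst multiplier_set_eq) (auto simp: floor_divide_of_nat_eq)
  then have "(\<Sum>x=1..n. real_of_int \<lfloor>real n / real x\<rfloor> * f x)
      = (\<Sum>x=1..n. \<Sum>m\<in>{m\<in>{1..n}. m * x \<le> n}. f x)"
    by (intro sum.cong) auto
  \<comment> \<open>The condition \<open>m * x \<le> n\<close> is symmetric in \<open>m\<close> and
    \<open>x\<close>, so after the exchange the inner range is again an initial segment.\<close>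
  also have "\<dots> = (\<Sum>m=1..n. \<Sum>x\<in>{x\<in>{1..n}. m * x \<le> n}. f x)"
    by (rule sum.swap_restrict) auto
  also have "\<dots> = (\<Sum>m=1..n. \<Sum>x=1..n div m. f x)"
  proof (intro sum.cong refl)
    fix m assume "m \<in> {1..n}"
    then show "{x\<in>{1..n}. m * x \<le> n} = {1..n div m}"
      using multiplier_set_eq[of m n] by (simp add: mult.commute[of m])
  qed
  finally show ?thesis .
qed

lemma harmonic_sum_le_sqrt: "(\<Sum>m=1..n. 1 / real m) \<le> 2 * sqrt (real n)"
proof (induction n)
  case (Suc n)
  define a b where "a = sqrt (real n)" and "b = sqrt (real (Suc n))"
  have ab: "0 \<le> a" "a \<le> b" "1 \<le> b" "b\<^sup>2 = real (Suc n)" "b\<^sup>2 - a\<^sup>2 = 1"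
    by (auto simp: a_def b_def)
  \<comment> \<open>The increment of 2 sqrt(n) has to dominate 1/(n+1). The lossy step b \<le> b^2,
    valid since b \<ge> 1, turns the natural bound 1/b into 1/b^2 = 1/(n+1).\<close>
  have "1 = (b - a) * (b + a)" using ab(5) by (simp add: algebra_simps power2_eq_square)
  also have "\<dots> \<le> (b - a) * (2 * b)" using ab by (intro mult_left_mono) auto
  also have "\<dots> \<le> (b - a) * (2 * b\<^sup>2)"
    using ab by (intro mult_left_mono self_le_power) auto
  finally have "1 / real (Suc n) \<le> 2 * (b - a)"
    using ab(4) by (simp add: field_simps)
  then show ?case using Suc.IH by (simp add: a_def b_def)
qed auto

text \<open>Since s + 1 \<ge> 2, each term of the tail is at most 1/(N(N+1)), and these telescope to
  1/n.\<close>

lemma zeta_partial_sum_approx: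
  assumes "s > 0" "n > 0"
  shows "\<bar>zeta (real s + 1) - (\<Sum>m=1..n. 1 / real m ^ (s + 1))\<bar> \<le> 1 / real n"
proof -
  define P where "P N = (\<Sum>m=1..N. 1 / real m ^ (s + 1))" for N
  have powr_eq: "real (Suc x) powr (- (real s + 1)) = 1 / real (Suc x) ^ (s + 1)" for x
    using powr_realpow[of "real (Suc x)" "s + 1"]
    by (simp only: powr_minus_divide) (simp add: add.commute)
  have "summable (\<lambda>x. inverse (real x ^ (s + 1)))"
    using assms by (intro inverse_power_summable) auto
  then have "summable (\<lambda>x. 1 / real (Suc x) ^ (s + 1))"
    by (subst (asm) summable_Suc_iff[symmetric]) (simp only: inverse_eq_divide)
  then have "(\<lambda>N. \<Sum>x<N. 1 / real (Suc x) ^ (s + 1)) \<longlonglongrightarrow> zeta (real s + 1)"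
    unfolding zeta_def powr_eq by (rule summable_LIMSEQ)
  moreover have "(\<Sum>x<N. 1 / real (Suc x) ^ (s + 1)) = P N" for N
    unfolding P_def by (induction N) auto
  ultimately have lim: "P \<longlonglongrightarrow> zeta (real s + 1)" by simp
  \<comment> \<open>Keeping the term - 1/N is what lets the induction close; it is dropped before
    passing to the limit.\<close>
  have bounds: "P n \<le> P N \<and> P N \<le> P n + 1 / real n - 1 / real N" if "n \<le> N" for N
    using that
  proof (induction N rule: dec_induct)
    case (step N)
    have N: "real N > 0" using assms step by simp
    have "real (Suc N) * real N \<le> real (Suc N) ^ 2" by (simp add: power2_eq_square)
    also have "\<dots> \<le> real (Suc N) ^ (s + 1)" using assms by (intro power_increasing) auto
    finally have "1 / real (Suc N) ^ (s + 1) \<le> 1 / (real (Suc N) * real N)"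
      using N by (intro divide_left_mono) auto
    also have "\<dots> = 1 / real N - 1 / real (Suc N)" using N by (simp add: field_simps)
    finally have "1 / real (Suc N) ^ (s + 1) \<le> 1 / real N - 1 / real (Suc N)" .
    moreover have "P (Suc N) = P N + 1 / real (Suc N) ^ (s + 1)" by (simp add: P_def)
    moreover have "0 \<le> 1 / real (Suc N) ^ (s + 1)" by simp
    ultimately show ?case using step.IH by linarith
  qed auto
  have "P n \<le> zeta (real s + 1)"
    using bounds by (intro LIMSEQ_le_const[OF lim]) auto
  moreover have "P N \<le> P n + 1 / real n" if "n \<le> N" for N
    using bounds[OF that] zero_le_divide_1_iff[of "real N"] by linarith
  then have "zeta (real s + 1) \<le> P n + 1 / real n"
    by (intro LIMSEQ_le_const2[OF lim]) auto
  ultimately show ?thesis by (simp add: P_def)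
qed

lemma sum_frac_mult_power_approx:
  assumes s: "s > 0" and n: "n > 0"
  shows "\<bar>(\<Sum>x=1..n. frac (real n / real x) * real x ^ s)
           - real n ^ (s + 1) * (1 / real s - zeta (real s + 1) / (real s + 1))\<bar>
         \<le> real n ^ (s + 1) * (4 / sqrt (real n))"
proof -
  define A where "A = (\<Sum>x=1..n. real x ^ (s - 1))"
  define B where "B = (\<Sum>m=1..n. \<Sum>x=1..n div m. real x ^ s)"
  define P where "P = (\<Sum>m=1..n. 1 / real m ^ (s + 1))"
  define z where "z = zeta (real s + 1)"
  \<comment> \<open>Writing s as a successor makes x^s / x = x^(s-1) available despite truncated
    subtraction, and t + 1 = s is the denominator of the main term of \<open>A\<close>.\<close>
  obtain t where t: "s = Suc t" using s gr0_conv_Suc by blast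
  have "frac (real n / real x) * real x ^ s
      = real n * real x ^ (s - 1) - real_of_int \<lfloor>real n / real x\<rfloor> * real x ^ s"
    if "x \<in> {1..n}" for x
    using that by (simp add: frac_def t field_simps)
  then have "(\<Sum>x=1..n. frac (real n / real x) * real x ^ s)
      = (\<Sum>x=1..n. real n * real x ^ (s - 1) - real_of_int \<lfloor>real n / real x\<rfloor> * real x ^ s)"
    by (intro sum.cong) auto
  also have "\<dots> = real n * A - B"
    unfolding A_def B_def sum_subtractf sum_floor_div_mult sum_distrib_left ..
  finally have split: "(\<Sum>x=1..n. frac (real n / real x) * real x ^ s) = real n * A - B" .

  have "\<bar>A - real n ^ s / real s\<bar> \<le> real n ^ t"
    using sum_power_upto_approx[of n "real n" t] by (simp add: A_def t add.commute)
  then have "real n * \<bar>A - real n ^ s / real s\<bar> \<le> real n * real n ^ t"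
    by (intro mult_left_mono) auto
  then have A: "\<bar>real n * A - real n ^ (s + 1) / real s\<bar> \<le> real n ^ s"
    using n by (simp add: abs_mult_pos' t algebra_simps)

  have "B - real n ^ (s + 1) * P / (real s + 1)
      = (\<Sum>m=1..n. (\<Sum>x=1..n div m. real x ^ s) - (real n / real m) ^ Suc s / (real s + 1))"
    by (simp add: B_def P_def sum_subtractf sum_distrib_left sum_divide_distrib power_divide)
  also have "\<bar>\<dots>\<bar> \<le> (\<Sum>m=1..n. real n ^ s * (1 / real m))"
  proof (rule order_trans[OF sum_abs], rule sum_mono)
    fix m assume m: "m \<in> {1..n}"
    have fl: "real (n div m) = real_of_int \<lfloor>real n / real m\<rfloor>"
      by (simp add: floor_divide_of_nat_eq)
    have "\<bar>(\<Sum>x=1..n div m. real x ^ s) - (real n / real m) ^ Suc s / (real s + 1)\<bar>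
        \<le> (real n / real m) ^ s"
      using floor_correct[of "real n / real m"]
      by (intro sum_power_upto_approx) (simp_all only: fl, linarith+)
    also have "\<dots> = real n ^ s * (1 / real m ^ s)" by (simp add: power_divide)
    \<comment> \<open>As s \<ge> 1, m^s \<ge> m. This reduces every s to the harmonic sum, with
      equality for s = 1.\<close>
    also have "\<dots> \<le> real n ^ s * (1 / real m)"
      using m s by (intro mult_left_mono divide_left_mono self_le_power) auto
    finally show "\<bar>(\<Sum>x=1..n div m. real x ^ s) - (real n / real m) ^ Suc s / (real s + 1)\<bar>
        \<le> real n ^ s * (1 / real m)" .
  qed
  also have "\<dots> \<le> real n ^ s * (2 * sqrt (real n))"
    unfolding sum_distrib_left[symmetric] by (intro mult_left_mono harmonic_sum_le_sqrt) auto
  finally have B: "\<bar>B - real n ^ (s + 1) * P / (real s + 1)\<bar> \<le> real n ^ s * (2 * sqrt (real n))" .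

  have "\<bar>z - P\<bar> / (real s + 1) \<le> \<bar>z - P\<bar> / 1"
    by (intro divide_left_mono) auto
  also have "\<dots> \<le> 1 / real n"
    using zeta_partial_sum_approx[OF s n] by (simp add: z_def P_def)
  finally have "real n ^ (s + 1) * (\<bar>z - P\<bar> / (real s + 1)) \<le> real n ^ (s + 1) * (1 / real n)"
    by (intro mult_left_mono) auto
  then have Z: "\<bar>real n ^ (s + 1) * z / (real s + 1) - real n ^ (s + 1) * P / (real s + 1)\<bar>
      \<le> real n ^ s"
    using n by (simp add: abs_mult flip: diff_divide_distrib right_diff_distrib)

  \<comment> \<open>The errors from \<open>A\<close>, \<open>B\<close> and \<open>Z\<close> are n^s,
    2 n^s sqrt(n) and n^s. As sqrt(n) \<ge> 1, they total at most 4 n^s sqrt(n), which is the source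
    of the constant 4.\<close>
  have "1 \<le> sqrt (real n)" using n by simp
  then have "real n ^ s * 1 \<le> real n ^ s * sqrt (real n)" by (intro mult_left_mono) auto
  moreover have "real n ^ (s + 1) * (4 / sqrt (real n)) = 4 * (real n ^ s * sqrt (real n))"
    using n by (simp add: field_simps)
  moreover have "real n ^ (s + 1) * (1 / real s - z / (real s + 1))
      = real n ^ (s + 1) / real s - real n ^ (s + 1) * z / (real s + 1)"
    by (simp add: algebra_simps)
  ultimately show ?thesis
    using A B Z unfolding split z_def[symmetric] by linarith
qed

theorem theorem4:
  fixes s :: nat
  assumes "s > 0"
  shows "(\<lambda>n::nat. 1 / real n ^ (s + 1) * (\<Sum>x=1..n. frac (real n / real x) * real x ^ s)
           - (1 / real s - zeta (real s + 1) / (real s + 1)))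
         \<in> O[at_top](\<lambda>n. 1 / sqrt (real n))"
proof (rule bigoI[where c = 4], rule eventually_mono[OF eventually_gt_at_top[of 0]])
  fix n :: nat assume n: "n > 0"
  define c where "c = 1 / real s - zeta (real s + 1) / (real s + 1)"
  define S where "S = (\<Sum>x=1..n. frac (real n / real x) * real x ^ s)"
  \<comment> \<open>Positivity allows the explicit bound to be divided by n^(s+1), which leaves
    exactly 4 / sqrt(n).\<close>
  have pos: "real n ^ (s + 1) > 0" using n by simp
  have "1 / real n ^ (s + 1) * S - c = (S - real n ^ (s + 1) * c) / real n ^ (s + 1)"
    using n by (simp add: diff_divide_distrib)
  also have "\<bar>\<dots>\<bar> = \<bar>S - real n ^ (s + 1) * c\<bar> / real n ^ (s + 1)"
    by simp
  also have "\<dots> \<le> 4 / sqrt (real n)"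
    using sum_frac_mult_power_approx[OF assms n] pos
    unfolding c_def[symmetric] S_def[symmetric] pos_divide_le_eq[OF pos]
    by (subst mult.commute)
  finally show "norm (1 / real n ^ (s + 1) * S - c) \<le> 4 * norm (1 / sqrt (real n))"
    by simp
qed

end
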